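(* Let $\mathcal E:=\mathbb C\setminus\{(-\infty,-1]\cup[1,+\infty)\}$ and let $$\tau=\left\{\begin{bmatrix} A & B \\ B^* & G \end{bmatrix};\mathfrak M,\mathfrak M,\mathcal K\right\}$$ be a passive selfadjoint system with transfer function $\Omega$. Let $a\in(-1,1)$. Then the passive selfadjoint system $$\sigma_a=\left\{\begin{bmatrix} (aI+A)(I+aA)^{-1} & \sqrt{1-a^2}\,(I+aA)^{-1}B \\ \sqrt{1-a^2}\,B^*(I+aA)^{-1} & G-aB^*(I+aA)^{-1}B \end{bmatrix};\mathfrak M,\mathfrak M,\mathcal K\right\}$$ has transfer function $$\widehat\Omega_a(z)=(aI+\Omega(z))(I+a\Omega(z))^{-1},\qquad z\in\mathcal E .$$
   Context: Hilbert spaces are complex and separable. A passive selfadjoint system $\{T;\mathfrak M,\mathfrak M,\mathcal K\}$ is given by a selfadjoint contraction $T=\begin{bmatrix} D & C \\ C^* & F \end{bmatrix}$ in $\mathfrak M\oplus\mathcal K$ (input-output space $\mathfrak M$, state space $\mathcal K$); its transfer function is $D+zC(I-zF)^{-1}C^*$, $z\in\mathcal E$. The claim includes that the block operator defining $\sigma_a$ is a selfadjoint contraction. *)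

theory Defs
  imports "HOL-Analysis.Analysis"
begin

section \<open>Complex separable Hilbert spaces\<close>

class scaleC =
  fixes scaleC :: "complex \<Rightarrow> 'a \<Rightarrow> 'a" (infixr "*\<^sub>C" 75)

class complex_normed_vector = real_normed_vector + scaleC +
  assumes scaleC_add_right: "c *\<^sub>C (x + y) = c *\<^sub>C x + c *\<^sub>C y"
    and scaleC_add_left: "(c + d) *\<^sub>C x = c *\<^sub>C x + d *\<^sub>C x"
    and scaleC_scaleC: "c *\<^sub>C d *\<^sub>C x = (c * d) *\<^sub>C x"
    and scaleC_of_real: "complex_of_real r *\<^sub>C x = r *\<^sub>R x"
    and norm_scaleC: "norm (c *\<^sub>C x) = cmod c * norm x"

text \<open>
  The inner product is linear in the first argument.  Positive definiteness and
  \<open>norm x = sqrt (Re (cinner x x))\<close> come from \<open>real_inner\<close> through \<open>inner_eq_Re_cinner\<close>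
  (\<open>cinner x x\<close> is real by \<open>cinner_commute\<close>).  Completeness and separability are those of
  \<open>polish_space\<close>.
\<close>
class complex_hilbert_space = complex_normed_vector + real_inner + polish_space +
  fixes cinner :: "'a \<Rightarrow> 'a \<Rightarrow> complex"
  assumes cinner_commute: "cinner x y = cnj (cinner y x)"
    and cinner_add_left: "cinner (x + y) w = cinner x w + cinner y w"
    and cinner_scaleC_left: "cinner (c *\<^sub>C x) y = c * cinner x y"
    and inner_eq_Re_cinner: "inner x y = Re (cinner x y)"

text \<open>The type \<open>'m \<times> 'k\<close> is the Hilbert direct sum.\<close>

instantiation prod :: (complex_normed_vector, complex_normed_vector) complex_normed_vector
begin

definition scaleC_prod :: "complex \<Rightarrow> 'a \<times> 'b \<Rightarrow> 'a \<times> 'b" where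
  "scaleC_prod c p = (c *\<^sub>C fst p, c *\<^sub>C snd p)"

instance
proof
  fix c d :: complex and r :: real and x y :: "'a \<times> 'b"
  show "c *\<^sub>C (x + y) = c *\<^sub>C x + c *\<^sub>C y"
    and "(c + d) *\<^sub>C x = c *\<^sub>C x + d *\<^sub>C x"
    and "c *\<^sub>C d *\<^sub>C x = (c * d) *\<^sub>C x"
    and "complex_of_real r *\<^sub>C x = r *\<^sub>R x"
    by (auto simp: scaleC_prod_def scaleC_add_right scaleC_add_left scaleC_scaleC
        scaleC_of_real prod_eq_iff)
  have "norm (c *\<^sub>C x) = sqrt ((cmod c)\<^sup>2 * ((norm (fst x))\<^sup>2 + (norm (snd x))\<^sup>2))"
    by (simp add: scaleC_prod_def norm_prod_def norm_scaleC power_mult_distrib distrib_left)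
  then show "norm (c *\<^sub>C x) = cmod c * norm x"
    by (simp add: norm_prod_def real_sqrt_mult)
qed

end

instance prod :: (polish_space, polish_space) polish_space ..

instantiation prod :: (complex_hilbert_space, complex_hilbert_space) complex_hilbert_space
begin

definition cinner_prod :: "'a \<times> 'b \<Rightarrow> 'a \<times> 'b \<Rightarrow> complex" where
  "cinner_prod p q = cinner (fst p) (fst q) + cinner (snd p) (snd q)"

instance
proof
  fix c :: complex and x y w :: "'a \<times> 'b"
  show "cinner x y = cnj (cinner y x)"
    using cinner_commute[of "fst x" "fst y"] cinner_commute[of "snd x" "snd y"]
    by (simp add: cinner_prod_def)
  show "cinner (x + y) w = cinner x w + cinner y w"
    by (simp add: cinner_prod_def cinner_add_left)
  show "cinner (c *\<^sub>C x) y = c * cinner x y"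
    by (simp add: cinner_prod_def scaleC_prod_def cinner_scaleC_left distrib_left)
  show "inner x y = Re (cinner x y)"
    by (simp add: cinner_prod_def inner_prod_def inner_eq_Re_cinner)
qed

end


section \<open>Bounded operators\<close>

text \<open>
  The library type \<open>'a \<Rightarrow>\<^sub>L 'b\<close> consists of the bounded \<^emph>\<open>real\<close>-linear maps; complex linearity
  is the predicate \<open>complex_linear\<close>.
\<close>

lemma bounded_linear_scaleC: "bounded_linear (\<lambda>x::'a::complex_normed_vector. c *\<^sub>C x)"
proof (rule bounded_linear_intro[where K = "cmod c"])
  fix x y :: 'a and r :: real
  show "c *\<^sub>C (x + y) = c *\<^sub>C x + c *\<^sub>C y"
    by (rule scaleC_add_right)
  show "c *\<^sub>C (r *\<^sub>R x) = r *\<^sub>R (c *\<^sub>C x)"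
    by (simp add: scaleC_scaleC mult.commute flip: scaleC_of_real)
  show "norm (c *\<^sub>C x) \<le> norm x * cmod c"
    by (simp add: norm_scaleC)
qed

instantiation blinfun :: (real_normed_vector, complex_normed_vector) complex_normed_vector
begin

lift_definition scaleC_blinfun :: "complex \<Rightarrow> 'a \<Rightarrow>\<^sub>L 'b \<Rightarrow> 'a \<Rightarrow>\<^sub>L 'b"
  is "\<lambda>c f x. c *\<^sub>C f x"
  by (rule bounded_linear_compose[OF bounded_linear_scaleC])

instance
proof
  fix c d :: complex and r :: real and f g :: "'a \<Rightarrow>\<^sub>L 'b"
  show "c *\<^sub>C (f + g) = c *\<^sub>C f + c *\<^sub>C g"
    by transfer (simp add: scaleC_add_right)
  show "(c + d) *\<^sub>C f = c *\<^sub>C f + d *\<^sub>C f"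
    by transfer (simp add: scaleC_add_left)
  show "c *\<^sub>C d *\<^sub>C f = (c * d) *\<^sub>C f"
    by transfer (simp add: scaleC_scaleC)
  show "complex_of_real r *\<^sub>C f = r *\<^sub>R f"
    by transfer (simp add: scaleC_of_real)
  have le: "norm (c *\<^sub>C f) \<le> cmod c * norm f" for c and f :: "'a \<Rightarrow>\<^sub>L 'b"
  proof (rule norm_blinfun_bound)
    fix x
    show "norm ((c *\<^sub>C f) x) \<le> cmod c * norm f * norm x"
      using mult_left_mono[OF norm_blinfun[of f x], of "cmod c"]
      by (simp add: scaleC_blinfun.rep_eq norm_scaleC mult.assoc)
  qed simp
  show "norm (c *\<^sub>C f) = cmod c * norm f"
  proof (cases "c = 0")
    case True
    then show ?thesis using le[of 0 f] by simp
  next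
    case False
    have "inverse c *\<^sub>C c *\<^sub>C f = complex_of_real 1 *\<^sub>C f"
      using False by transfer (simp add: scaleC_scaleC)
    also have "\<dots> = f"
      by transfer (simp only: scaleC_of_real scaleR_one)
    finally have "norm f \<le> cmod (inverse c) * norm (c *\<^sub>C f)"
      using le[of "inverse c" "c *\<^sub>C f"] by simp
    then have "cmod c * norm f \<le> norm (c *\<^sub>C f)"
      using False by (simp add: norm_divide field_simps)
    with le[of c f] show ?thesis by simp
  qed
qed

end

definition complex_linear :: "('a::complex_normed_vector \<Rightarrow>\<^sub>L 'b::complex_normed_vector) \<Rightarrow> bool"
  where "complex_linear S \<longleftrightarrow> (\<forall>c x. S (c *\<^sub>C x) = c *\<^sub>C S x)"

definition cadjoint ::
    "('a::complex_hilbert_space \<Rightarrow>\<^sub>L 'b::complex_hilbert_space) \<Rightarrow> ('b \<Rightarrow>\<^sub>L 'a)"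
  where "cadjoint S = (THE R :: 'b \<Rightarrow>\<^sub>L 'a. \<forall>x y. cinner (S x) y = cinner x (R y))"

definition selfadjoint :: "('a::complex_hilbert_space \<Rightarrow>\<^sub>L 'a) \<Rightarrow> bool"
  where "selfadjoint S \<longleftrightarrow> (\<forall>x y. cinner (S x) y = cinner x (S y))"

definition op_invertible :: "('a::real_normed_vector \<Rightarrow>\<^sub>L 'a) \<Rightarrow> bool"
  where "op_invertible S \<longleftrightarrow> (\<exists>R. S o\<^sub>L R = id_blinfun \<and> R o\<^sub>L S = id_blinfun)"

text \<open>Meaningful only if \<open>op_invertible S\<close>.\<close>
definition op_inverse :: "('a::real_normed_vector \<Rightarrow>\<^sub>L 'a) \<Rightarrow> ('a \<Rightarrow>\<^sub>L 'a)"
  where "op_inverse S = (THE R. S o\<^sub>L R = id_blinfun \<and> R o\<^sub>L S = id_blinfun)"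


section \<open>Block operators\<close>

definition inl_blinfun :: "'m::real_normed_vector \<Rightarrow>\<^sub>L ('m \<times> 'k::real_normed_vector)"
  where "inl_blinfun = Blinfun (\<lambda>x. (x, 0))"

definition inr_blinfun :: "'k::real_normed_vector \<Rightarrow>\<^sub>L ('m::real_normed_vector \<times> 'k)"
  where "inr_blinfun = Blinfun (\<lambda>y. (0, y))"

text \<open>\<open>block_op D C E F\<close> is the operator matrix with rows \<open>D C\<close> and \<open>E F\<close>.\<close>
definition block_op ::
    "('m::real_normed_vector \<Rightarrow>\<^sub>L 'm) \<Rightarrow> ('k::real_normed_vector \<Rightarrow>\<^sub>L 'm) \<Rightarrow>
     ('m \<Rightarrow>\<^sub>L 'k) \<Rightarrow> ('k \<Rightarrow>\<^sub>L 'k) \<Rightarrow> (('m \<times> 'k) \<Rightarrow>\<^sub>L ('m \<times> 'k))"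
  where "block_op D C E F = Blinfun (\<lambda>(x, y). (D x + C y, E x + F y))"

lemma inl_blinfun_apply: "inl_blinfun x = (x, 0)"
  unfolding inl_blinfun_def
  by (subst bounded_linear_Blinfun_apply)
    (auto intro!: bounded_linear_Pair bounded_linear_ident bounded_linear_zero)

lemma inr_blinfun_apply: "inr_blinfun y = (0, y)"
  unfolding inr_blinfun_def
  by (subst bounded_linear_Blinfun_apply)
    (auto intro!: bounded_linear_Pair bounded_linear_ident bounded_linear_zero)

lemma block_op_apply: "block_op D C E F (x, y) = (D x + C y, E x + F y)"
proof -
  have "bounded_linear (\<lambda>p. (D (fst p) + C (snd p), E (fst p) + F (snd p)))"
    by (intro bounded_linear_Pair bounded_linear_add
        bounded_linear_compose[OF blinfun.bounded_linear_right]
        bounded_linear_fst bounded_linear_snd)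
  then show ?thesis
    by (simp add: block_op_def case_prod_unfold bounded_linear_Blinfun_apply)
qed

definition block11 ::
    "(('m::real_normed_vector \<times> 'k::real_normed_vector) \<Rightarrow>\<^sub>L ('m \<times> 'k)) \<Rightarrow> ('m \<Rightarrow>\<^sub>L 'm)"
  where "block11 T = fst_blinfun o\<^sub>L T o\<^sub>L inl_blinfun"

definition block12 ::
    "(('m::real_normed_vector \<times> 'k::real_normed_vector) \<Rightarrow>\<^sub>L ('m \<times> 'k)) \<Rightarrow> ('k \<Rightarrow>\<^sub>L 'm)"
  where "block12 T = fst_blinfun o\<^sub>L T o\<^sub>L inr_blinfun"

definition block22 ::
    "(('m::real_normed_vector \<times> 'k::real_normed_vector) \<Rightarrow>\<^sub>L ('m \<times> 'k)) \<Rightarrow> ('k \<Rightarrow>\<^sub>L 'k)"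
  where "block22 T = snd_blinfun o\<^sub>L T o\<^sub>L inr_blinfun"

lemma block11_block_op: "block11 (block_op D C E F) = D"
  by (rule blinfun_eqI) (simp add: block11_def block_op_apply inl_blinfun_apply)

lemma block12_block_op: "block12 (block_op D C E F) = C"
  by (rule blinfun_eqI) (simp add: block12_def block_op_apply inr_blinfun_apply)

lemma block22_block_op: "block22 (block_op D C E F) = F"
  by (rule blinfun_eqI) (simp add: block22_def block_op_apply inr_blinfun_apply)


section \<open>Passive selfadjoint systems\<close>

text \<open>
  A system with input-output space \<open>'m\<close> and state space \<open>'k\<close> is identified with its block
  operator \<open>T\<close>.  Selfadjointness of \<open>T\<close> makes the lower left block the adjoint of \<open>block12 T\<close>.
\<close>
definition passive_selfadjoint_system ::
    "(('m::complex_hilbert_space \<times> 'k::complex_hilbert_space) \<Rightarrow>\<^sub>L ('m \<times> 'k)) \<Rightarrow> bool"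
  where "passive_selfadjoint_system T \<longleftrightarrow> complex_linear T \<and> selfadjoint T \<and> norm T \<le> 1"

definition slit_plane :: "complex set" (\<open>\<E>\<close>)
  where "\<E> = UNIV - complex_of_real ` ({..-1} \<union> {1..})"

definition transfer_function ::
    "(('m::complex_hilbert_space \<times> 'k::complex_hilbert_space) \<Rightarrow>\<^sub>L ('m \<times> 'k)) \<Rightarrow>
     complex \<Rightarrow> ('m \<Rightarrow>\<^sub>L 'm)"
  where "transfer_function T z =
    block11 T +
    z *\<^sub>C (block12 T o\<^sub>L op_inverse (id_blinfun - z *\<^sub>C block22 T) o\<^sub>L cadjoint (block12 T))"

end

theory Submission
  imports Defs
begin

text \<open>
  The transformation \<open>\<tau> \<mapsto> \<sigma>\<^sub>a\<close> is a hyperbolic rotation of the input and output of the system, which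
  leaves the state untouched; hence it preserves contractivity.  The main operator of
  \<open>\<sigma>\<^sub>a\<close> makes \<open>I - z (G - a B* (I + a A)\<^sup>-\<^sup>1 B)\<close> the Schur complement that occurs in the Woodbury
  formula for \<open>(I + a \<Omega>(z))\<^sup>-\<^sup>1\<close>.  Both state resolvents exist for \<open>z \<in> \<E>\<close> because the main
  operator of a passive selfadjoint system is a selfadjoint contraction, so \<open>I + a \<Omega>(z)\<close> is
  invertible too and the Mobius formula becomes an algebraic identity.
\<close>

section \<open>Complex Hilbert spaces\<close>

lemma scaleC_zero_right: "c *\<^sub>C (0::'a::complex_normed_vector) = 0"
  using norm_scaleC[of c 0] by simp

lemma scaleC_minus_right: "c *\<^sub>C (- x) = - (c *\<^sub>C (x::'a::complex_normed_vector))"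
  by (simp add: eq_neg_iff_add_eq_0 scaleC_zero_right flip: scaleC_add_right)

lemma scaleC_diff_right: "c *\<^sub>C (x - y) = c *\<^sub>C x - c *\<^sub>C (y::'a::complex_normed_vector)"
  using scaleC_add_right[of c x "- y"] by (simp add: scaleC_minus_right)

lemma scaleC_scaleR: "c *\<^sub>C (r *\<^sub>R x) = r *\<^sub>R (c *\<^sub>C (x::'a::complex_normed_vector))"
  by (simp add: scaleC_scaleC mult.commute flip: scaleC_of_real)

lemma scaleC_one: "1 *\<^sub>C (x::'a::complex_normed_vector) = x"
  using scaleC_of_real[of 1 x] by simp

lemma cinner_add_right: "cinner w (x + y) = cinner w x + cinner w (y::'a::complex_hilbert_space)"
  by (subst (1 2 3) cinner_commute) (simp add: cinner_add_left)

lemma cinner_scaleC_right: "cinner x (c *\<^sub>C y) = cnj c * cinner x (y::'a::complex_hilbert_space)"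
  by (subst (1 2) cinner_commute) (simp add: cinner_scaleC_left)

lemma cinner_scaleR_left: "cinner (r *\<^sub>R x) y = r * cinner x (y::'a::complex_hilbert_space)"
  by (simp add: cinner_scaleC_left flip: scaleC_of_real)

lemma cinner_scaleR_right: "cinner x (r *\<^sub>R y) = r * cinner x (y::'a::complex_hilbert_space)"
  by (simp add: cinner_scaleC_right flip: scaleC_of_real)

lemma cinner_zero_left: "cinner 0 (y::'a::complex_hilbert_space) = 0"
  using cinner_scaleR_left[of 0 0 y] by simp

lemma cinner_zero_right: "cinner x (0::'a::complex_hilbert_space) = 0"
  using cinner_scaleR_right[of x 0 0] by simp

lemma cinner_diff_left: "cinner (x - y) w = cinner x w - cinner y (w::'a::complex_hilbert_space)"
  using cinner_add_left[of "x - y" y w] by simp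

lemma cinner_diff_right: "cinner w (x - y) = cinner w x - cinner w (y::'a::complex_hilbert_space)"
  using cinner_add_right[of w "x - y" y] by simp

lemma cinner_right_eqI:
  fixes x y :: "'a::complex_hilbert_space"
  assumes "\<And>w. cinner w x = cinner w y"
  shows "x = y"
proof -
  have "inner (x - y) (x - y) = 0"
    by (simp add: inner_eq_Re_cinner cinner_diff_right assms)
  then show ?thesis by simp
qed

text \<open>Nondegeneracy of the inner product makes adjoints unique, so exhibiting one candidate
  resolves the definite description.\<close>

lemma cadjoint_eqI:
  fixes S :: "'a::complex_hilbert_space \<Rightarrow>\<^sub>L 'b::complex_hilbert_space"
    and S' :: "'b \<Rightarrow>\<^sub>L 'a"
  assumes "\<And>x y. cinner (S x) y = cinner x (S' y)"
  shows "cadjoint S = S'"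
  unfolding cadjoint_def
proof (rule the_equality)
  fix S'' :: "'b \<Rightarrow>\<^sub>L 'a" assume S'': "\<forall>x y. cinner (S x) y = cinner x (S'' y)"
  show "S'' = S'"
  proof (rule blinfun_eqI)
    fix y
    show "S'' y = S' y"
      by (rule cinner_right_eqI) (simp flip: assms S''[rule_format])
  qed
qed (use assms in simp)


section \<open>Invertible operators\<close>

lemma blinfun_compose_eq_idD: "S o\<^sub>L R = id_blinfun \<Longrightarrow> S (R x) = x"
  by (metis blinfun_apply_blinfun_compose blinfun_apply_id_blinfun)

lemma op_inverse_eqI:
  assumes "S o\<^sub>L R = id_blinfun" and "R o\<^sub>L S = id_blinfun"
  shows "op_inverse S = R"
  unfolding op_inverse_def
proof (rule the_equality)
  fix R' assume R': "S o\<^sub>L R' = id_blinfun \<and> R' o\<^sub>L S = id_blinfun"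
  show "R' = R"
    by (rule blinfun_eqI) (metis R' assms(1) blinfun_compose_eq_idD)
qed (use assms in simp)

lemma
  assumes "op_invertible S"
  shows op_inverse_right: "S (op_inverse S x) = x"
    and op_inverse_left: "op_inverse S (S x) = x"
proof -
  obtain R where R: "S o\<^sub>L R = id_blinfun" "R o\<^sub>L S = id_blinfun"
    using assms unfolding op_invertible_def by blast
  from op_inverse_eqI[OF this] R show "S (op_inverse S x) = x" "op_inverse S (S x) = x"
    by (simp_all add: blinfun_compose_eq_idD)
qed

text \<open>\<open>op_inverse\<close> ranges over real-linear maps, so complex linearity has to be
  transported through \<open>S\<close>.\<close>

lemma complex_linear_op_inverse:
  assumes "complex_linear S" and "op_invertible S"
  shows "complex_linear (op_inverse S)"
  unfolding complex_linear_def
  by (metis assms complex_linear_def op_inverse_left op_inverse_right)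

text \<open>A solution of \<open>S x = y\<close> is a fixed point of the strict contraction
  \<open>x \<mapsto> x - t (S x - y)\<close> for small \<open>t > 0\<close>.\<close>
lemma coercive_op_invertible:
  fixes S :: "'a::{real_inner, complete_space} \<Rightarrow>\<^sub>L 'a"
  assumes c: "c > 0" and coercive: "\<And>x. inner (S x) x \<ge> c * (norm x)\<^sup>2"
  shows "op_invertible S"
proof -
  have bound: "c * norm x \<le> norm (S x)" for x
  proof (cases "x = 0")
    case False
    have "c * norm x * norm x \<le> norm (S x) * norm x"
      using coercive[of x] norm_cauchy_schwarz[of "S x" x] by (simp add: power2_eq_square)
    then show ?thesis using False by simp
  qed simp
  \<comment> \<open>The estimate below has the factor
    \<open>1 - 2 * (t * c) + t\<^sup>2 * M\<^sup>2\<close>; \<open>t = c / M\<^sup>2\<close>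
    minimises it and \<open>q\<close> is the minimum. Adding \<open>c\<close> to
    \<open>norm S\<close> ensures \<open>0 < c \<le> M\<close>, hence
    \<open>0 \<le> q < 1\<close>.\<close>
  define M where "M = norm S + c"
  have M: "M \<ge> c" "M > 0" unfolding M_def using c by (simp_all add: add_nonneg_pos)
  define q where "q = 1 - c\<^sup>2 / M\<^sup>2"
  define t where "t = c / M\<^sup>2"
  have t: "t > 0" unfolding t_def using c M by simp
  have q: "0 \<le> q" "q < 1"
    unfolding q_def using c M by (simp_all add: power_mono)
  have contr: "norm (x - t *\<^sub>R S x) \<le> sqrt q * norm x" for x
  proof -
    have "norm (S x) \<le> M * norm x"
      using norm_blinfun[of S x] c by (simp add: M_def distrib_right add_increasing2)
    then have SM: "(norm (S x))\<^sup>2 \<le> M\<^sup>2 * (norm x)\<^sup>2"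
      by (metis norm_ge_zero power_mono power_mult_distrib)
    have "(norm (x - t *\<^sub>R S x))\<^sup>2 = (norm x)\<^sup>2 - 2 * t * inner (S x) x + t\<^sup>2 * (norm (S x))\<^sup>2"
      unfolding power2_norm_eq_inner
      by (simp add: inner_diff inner_commute[of x "S x"] power2_eq_square algebra_simps)
    also have "\<dots> \<le> (norm x)\<^sup>2 - 2 * t * (c * (norm x)\<^sup>2) + t\<^sup>2 * (M\<^sup>2 * (norm x)\<^sup>2)"
    proof -
      have "2 * t * (c * (norm x)\<^sup>2) \<le> 2 * t * inner (S x) x"
        using t by (intro mult_left_mono[OF coercive]) simp
      moreover have "t\<^sup>2 * (norm (S x))\<^sup>2 \<le> t\<^sup>2 * (M\<^sup>2 * (norm x)\<^sup>2)"
        by (rule mult_left_mono[OF SM]) simp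
      ultimately show ?thesis by linarith
    qed
    also have "\<dots> = (1 - 2 * (t * c) + t\<^sup>2 * M\<^sup>2) * (norm x)\<^sup>2"
      by (simp add: algebra_simps)
    also have "1 - 2 * (t * c) + t\<^sup>2 * M\<^sup>2 = q"
      unfolding q_def t_def using M by (simp add: power_divide power2_eq_square)
    finally have "norm (x - t *\<^sub>R S x) \<le> sqrt (q * (norm x)\<^sup>2)"
      by (rule real_le_rsqrt)
    then show ?thesis by (simp add: real_sqrt_mult)
  qed
  have surj: "\<exists>x. S x = y" for y
  proof -
    have "\<exists>!x. x - t *\<^sub>R (S x - y) = x"
    proof (rule banach_fix_type[where c = "sqrt q"])
      have "dist (x - t *\<^sub>R (S x - y)) (x' - t *\<^sub>R (S x' - y)) \<le> sqrt q * dist x x'" for x x'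
      proof -
        have "x - t *\<^sub>R (S x - y) - (x' - t *\<^sub>R (S x' - y)) = (x - x') - t *\<^sub>R S (x - x')"
          by (simp add: blinfun.diff_right algebra_simps)
        then show ?thesis
          using contr[of "x - x'"] by (simp only: dist_norm)
      qed
      then show "\<forall>x x'. dist (x - t *\<^sub>R (S x - y)) (x' - t *\<^sub>R (S x' - y)) \<le> sqrt q * dist x x'"
        by blast
    qed (use q in auto)
    then obtain x where "x - t *\<^sub>R (S x - y) = x" by blast
    then have "S x = y" using t by simp
    then show ?thesis ..
  qed
  then obtain r where r: "S (r y) = y" for y by metis
  have inj: "x = x'" if "S x = S x'" for x x'
  proof -
    have "c * norm (x - x') \<le> 0"
      using bound[of "x - x'"] that by (simp add: blinfun.diff_right)
    with c show ?thesis by (simp add: mult_le_0_iff)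
  qed
  \<comment> \<open>Injectivity of \<open>S\<close> makes its right inverse \<open>r\<close> linear,
    and the lower bound on \<open>norm (S x)\<close> bounds it.\<close>
  have "bounded_linear r"
  proof (rule bounded_linear_intro[where K = "1 / c"])
    show "r (x + y) = r x + r y" for x y
      by (rule inj) (simp add: r blinfun.add_right)
    show "r (s *\<^sub>R x) = s *\<^sub>R r x" for s x
      by (rule inj) (simp add: r blinfun.scaleR_right)
    show "norm (r x) \<le> norm x * (1 / c)" for x
      using bound[of "r x"] c by (simp add: r field_simps)
  qed
  then have *: "Blinfun r y = r y" for y
    by (simp add: bounded_linear_Blinfun_apply)
  have "S o\<^sub>L Blinfun r = id_blinfun"
    by (rule blinfun_eqI) (simp add: * r)
  moreover have "Blinfun r o\<^sub>L S = id_blinfun"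
    by (rule blinfun_eqI) (simp add: * inj r)
  ultimately show ?thesis
    unfolding op_invertible_def by blast
qed

text \<open>Allows a quadratic form to be rotated into the right half-plane before coercivity is
  tested. The factor \<open>w\<close> is put on the input side of \<open>?R\<close>, which is only
  known to be real-linear.\<close>

lemma op_invertible_scaleC_cancel:
  fixes S :: "'a::complex_normed_vector \<Rightarrow>\<^sub>L 'a"
  assumes w: "w \<noteq> 0" and inv: "op_invertible (w *\<^sub>C S)"
  shows "op_invertible S"
proof -
  let ?R = "op_inverse (w *\<^sub>C S)"
  have R: "w *\<^sub>C S (?R x) = x" "?R (w *\<^sub>C S x) = x" for x
    using op_inverse_right[OF inv, of x] op_inverse_left[OF inv, of x]
    by (simp_all add: scaleC_blinfun.rep_eq)
  have "S (?R (w *\<^sub>C x)) = x" for x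
  proof -
    have "inverse w *\<^sub>C (w *\<^sub>C S (?R (w *\<^sub>C x))) = inverse w *\<^sub>C (w *\<^sub>C x)"
      by (simp only: R)
    then show ?thesis using w by (simp add: scaleC_scaleC scaleC_one)
  qed
  then have "S o\<^sub>L (?R o\<^sub>L (w *\<^sub>C id_blinfun)) = id_blinfun"
    by (intro blinfun_eqI) (simp add: scaleC_blinfun.rep_eq)
  moreover have "(?R o\<^sub>L (w *\<^sub>C id_blinfun)) o\<^sub>L S = id_blinfun"
    by (intro blinfun_eqI) (simp add: scaleC_blinfun.rep_eq R)
  ultimately show ?thesis
    unfolding op_invertible_def by blast
qed

lemma norm_blinfun_le_1D: "norm S \<le> 1 \<Longrightarrow> norm (blinfun_apply S x) \<le> norm x"
  using norm_blinfun[of S x] mult_right_mono[of "norm S" 1 "norm x"] by simp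

text \<open>By Cauchy-Schwarz the quadratic form is coercive with constant
  \<open>1 - \<bar>a\<bar>\<close>.\<close>

lemma op_invertible_id_add_scaleR:
  fixes S :: "'a::complex_hilbert_space \<Rightarrow>\<^sub>L 'a"
  assumes S: "norm S \<le> 1" and a: "\<bar>a\<bar> < 1"
  shows "op_invertible (id_blinfun + a *\<^sub>R S)"
proof (rule coercive_op_invertible)
  show "1 - \<bar>a\<bar> > 0" using a by simp
  fix x
  have "\<bar>inner (S x) x\<bar> \<le> norm x * norm x"
    using Cauchy_Schwarz_ineq2[of "S x" x] norm_blinfun_le_1D[OF S, of x]
    by (meson mult_right_mono norm_ge_zero order_trans)
  then have "\<bar>a * inner (S x) x\<bar> \<le> \<bar>a\<bar> * (norm x)\<^sup>2"
    by (simp add: abs_mult mult_left_mono power2_eq_square)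
  then show "inner ((id_blinfun + a *\<^sub>R S) x) x \<ge> (1 - \<bar>a\<bar>) * (norm x)\<^sup>2"
    by (simp add: blinfun.bilinear_simps inner_add_left power2_norm_eq_inner algebra_simps)
qed

text \<open>The values \<open>1 - z t\<close>, \<open>-1 \<le> t \<le> 1\<close>, of the quadratic form of \<open>I - z F\<close> on unit vectors fill
  a segment missing \<open>0\<close>; multiplication by \<open>w = 1 + \<i> Re z / Im z\<close> moves it onto \<open>Re = 1\<close>
  when \<open>z\<close> is not real.\<close>
lemma op_invertible_id_diff_scaleC:
  fixes F :: "'a::complex_hilbert_space \<Rightarrow>\<^sub>L 'a"
  assumes F: "norm F \<le> 1" "selfadjoint F" and z: "z \<in> \<E>"
  shows "op_invertible (id_blinfun - z *\<^sub>C F)"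
proof -
  have real: "cinner (F x) x = complex_of_real (inner (F x) x)" for x
  proof -
    have "cinner (F x) x = cnj (cinner (F x) x)"
      using F(2) cinner_commute[of "F x" x] unfolding selfadjoint_def by simp
    then have "Im (cinner (F x) x) = - Im (cinner (F x) x)"
      by (metis cnj.simps(2))
    then show ?thesis by (simp add: complex_eq_iff inner_eq_Re_cinner)
  qed
  have self: "cinner x x = complex_of_real ((norm x)\<^sup>2)" for x :: 'a
    using cinner_commute[of x x]
    by (simp add: complex_eq_iff power2_norm_eq_inner inner_eq_Re_cinner)
  \<comment> \<open>Since \<open>cinner x x\<close> and \<open>cinner (F x) x\<close> are real, only
    the real parts of \<open>w\<close> and \<open>w * z\<close> enter.\<close>
  have form: "inner ((w *\<^sub>C (id_blinfun - z *\<^sub>C F)) x) x =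
      Re w * (norm x)\<^sup>2 - Re (w * z) * inner (F x) x" for w x
  proof -
    have "inner ((w *\<^sub>C (id_blinfun - z *\<^sub>C F)) x) x =
        Re (w * (complex_of_real ((norm x)\<^sup>2) - z * complex_of_real (inner (F x) x)))"
      unfolding inner_eq_Re_cinner[of "_ x" x]
      by (simp add: scaleC_blinfun.rep_eq cinner_scaleC_left blinfun.bilinear_simps
          cinner_diff_left self real)
    then show ?thesis by (simp add: algebra_simps)
  qed
  have Fx: "\<bar>inner (F x) x\<bar> \<le> (norm x)\<^sup>2" for x
    using Cauchy_Schwarz_ineq2[of "F x" x]
      mult_right_mono[OF norm_blinfun_le_1D[OF F(1), of x] norm_ge_zero[of x]]
    by (simp add: power2_eq_square)
  \<comment> \<open>With \<open>Fx\<close>, the last inequality is coercivity of \<open>form\<close>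
    with constant \<open>c\<close>. On the real axis the slits leave only
    \<open>\<bar>z\<bar> < 1\<close>, and \<open>w = 1\<close> works; otherwise \<open>w\<close> is
    chosen to make \<open>w * z\<close> purely imaginary.\<close>
  have "\<exists>w c. Re w > 0 \<and> c > 0 \<and> \<bar>Re (w * z)\<bar> \<le> Re w - c"
  proof (cases "Im z = 0")
    case True
    then have "z = complex_of_real (Re z)" by (simp add: complex_eq_iff)
    with z have "Re z \<notin> {..-1} \<union> {1..}"
      unfolding slit_plane_def by blast
    then have "\<bar>Re z\<bar> < 1" by auto
    then show ?thesis
      by (intro exI[of _ 1] exI[of _ "1 - \<bar>Re z\<bar>"]) simp
  next
    case False
    then show ?thesis
      by (intro exI[of _ "Complex 1 (Re z / Im z)"] exI[of _ 1]) simp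
  qed
  then obtain w c where w: "Re w > 0" "c > 0" "\<bar>Re (w * z)\<bar> \<le> Re w - c" by blast
  have "op_invertible (w *\<^sub>C (id_blinfun - z *\<^sub>C F))"
  proof (rule coercive_op_invertible[OF w(2)])
    fix x
    have "\<bar>Re (w * z) * inner (F x) x\<bar> \<le> (Re w - c) * (norm x)\<^sup>2"
      unfolding abs_mult by (rule mult_mono[OF w(3) Fx]) (use w(3) in auto)
    then show "inner ((w *\<^sub>C (id_blinfun - z *\<^sub>C F)) x) x \<ge> c * (norm x)\<^sup>2"
      unfolding form by (simp add: algebra_simps abs_le_iff)
  qed
  moreover have "w \<noteq> 0" using w(1) by auto
  ultimately show ?thesis by (rule op_invertible_scaleC_cancel[rotated])
qed

text \<open>The Woodbury identity for \<open>P + c B K\<^sup>-\<^sup>1 C\<close>, whose Schur complement is \<open>K + c C P\<^sup>-\<^sup>1 B\<close>.\<close>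
lemma woodbury:
  fixes P R :: "'m::complex_normed_vector \<Rightarrow>\<^sub>L 'm"
    and K Q V :: "'k::complex_normed_vector \<Rightarrow>\<^sub>L 'k"
    and B :: "'k \<Rightarrow>\<^sub>L 'm" and C :: "'m \<Rightarrow>\<^sub>L 'k"
  assumes lin: "complex_linear P" "complex_linear R" "complex_linear B" "complex_linear C"
      "complex_linear Q" "complex_linear V"
    and R: "\<And>x. P (R x) = x" "\<And>x. R (P x) = x"
    and Q: "\<And>y. K (Q y) = y" "\<And>y. Q (K y) = y"
    and V: "\<And>y. K (V y) + c *\<^sub>C C (R (B (V y))) = y" "\<And>y. V (K y + c *\<^sub>C C (R (B y))) = y"
  defines "W \<equiv> R - c *\<^sub>C (R o\<^sub>L B o\<^sub>L V o\<^sub>L C o\<^sub>L R)"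
  shows woodbury_right: "(P + c *\<^sub>C (B o\<^sub>L Q o\<^sub>L C)) o\<^sub>L W = id_blinfun"
    and woodbury_left: "W o\<^sub>L (P + c *\<^sub>C (B o\<^sub>L Q o\<^sub>L C)) = id_blinfun"
    and woodbury_feedback: "Q (C (W x)) = V (C (R x))"
proof -
  note l = lin[unfolded complex_linear_def, rule_format]
  have W: "W x = R x - c *\<^sub>C R (B (V (C (R x))))" for x
    by (simp add: W_def blinfun.bilinear_simps scaleC_blinfun.rep_eq)
  \<comment> \<open>Push-through identity: the right-inverse half of \<open>V\<close> turns
    \<open>C W\<close> into \<open>K V C R\<close>, and \<open>Q\<close> cancels
    \<open>K\<close>.\<close>
  have QCW: "Q (C (W x)) = V (C (R x))" for x
  proof -
    have "C (W x) = C (R x) - c *\<^sub>C C (R (B (V (C (R x)))))"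
      by (simp add: W blinfun.diff_right l)
    also have "\<dots> = K (V (C (R x)))"
      using V(1)[of "C (R x)"] by (simp add: algebra_simps)
    finally show ?thesis by (simp add: Q)
  qed
  then show "Q (C (W x)) = V (C (R x))" .
  \<comment> \<open>The mirror image, from the left-inverse half of \<open>V\<close> applied to
    \<open>Q y\<close>.\<close>
  have WBQ: "W (B (Q y)) = R (B (V y))" for y
  proof -
    have "V y + c *\<^sub>C V (C (R (B (Q y)))) = Q y"
      using V(2)[of "Q y"] by (simp add: Q blinfun.add_right l)
    then have "V y = Q y - c *\<^sub>C V (C (R (B (Q y))))" by (simp add: algebra_simps)
    then show ?thesis by (simp add: W blinfun.diff_right l)
  qed
  show "(P + c *\<^sub>C (B o\<^sub>L Q o\<^sub>L C)) o\<^sub>L W = id_blinfun"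
  proof (rule blinfun_eqI)
    fix x
    show "((P + c *\<^sub>C (B o\<^sub>L Q o\<^sub>L C)) o\<^sub>L W) x = id_blinfun x"
      by (simp add: blinfun.add_left scaleC_blinfun.rep_eq QCW)
        (simp add: W blinfun.diff_right l R)
  qed
  show "W o\<^sub>L (P + c *\<^sub>C (B o\<^sub>L Q o\<^sub>L C)) = id_blinfun"
  proof (rule blinfun_eqI)
    fix x
    have "W (c *\<^sub>C y) = c *\<^sub>C W y" for y
      by (simp add: W l scaleC_diff_right)
    then show "(W o\<^sub>L (P + c *\<^sub>C (B o\<^sub>L Q o\<^sub>L C))) x = id_blinfun x"
      by (simp add: blinfun.add_left blinfun.add_right scaleC_blinfun.rep_eq WBQ)
        (simp add: W R)
  qed
qed


section \<open>Passive selfadjoint systems\<close>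

text \<open>Selfadjointness of the block operator also forces \<open>C\<close> to be a genuine adjoint, so that
  the junk value of \<open>cadjoint\<close> never occurs.\<close>
lemma selfadjoint_block_op_iff:
  "selfadjoint (block_op D B C F) \<longleftrightarrow>
    selfadjoint D \<and> selfadjoint F \<and> (\<forall>x y. cinner (B y) x = cinner y (C x))" (is "?L \<longleftrightarrow> ?R")
proof
  assume L: ?L
  have eq: "cinner (D x + B y) x' + cinner (C x + F y) y' =
      cinner x (D x' + B y') + cinner y (C x' + F y')" for x y x' y'
    using L[unfolded selfadjoint_def, rule_format, of "(x, y)" "(x', y')"]
    by (simp add: block_op_apply cinner_prod_def)
  show ?R
    unfolding selfadjoint_def
    using eq[of _ 0 _ 0] eq[of 0 _ 0 _] eq[of 0 _ _ 0]
    by (simp add: cinner_zero_left cinner_zero_right)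
next
  assume R: ?R
  have "cinner (C x) y = cinner x (B y)" for x y
    using R by (metis cinner_commute)
  with R show ?L
    unfolding selfadjoint_def
    by (auto simp: block_op_apply cinner_prod_def cinner_add_left cinner_add_right)
qed

lemma complex_linear_block_op_iff:
  "complex_linear (block_op D B C F) \<longleftrightarrow>
    complex_linear D \<and> complex_linear B \<and> complex_linear C \<and> complex_linear F" (is "?L \<longleftrightarrow> ?R")
proof
  assume L: ?L
  have eq: "D (c *\<^sub>C x) + B (c *\<^sub>C y) = c *\<^sub>C (D x + B y)"
    "C (c *\<^sub>C x) + F (c *\<^sub>C y) = c *\<^sub>C (C x + F y)" for c x y
    using L[unfolded complex_linear_def, rule_format, of c "(x, y)"]
    by (simp_all add: block_op_apply scaleC_prod_def)
  show ?R
    unfolding complex_linear_def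
    using eq[of _ _ 0] eq[of _ 0] by (simp add: scaleC_zero_right)
qed (auto simp: complex_linear_def block_op_apply scaleC_prod_def scaleC_add_right)

text \<open>Pythagorean form of contractivity: an energy inequality, on which the hyperbolic
  rotation can act.\<close>

lemma norm_block_op_le_1_iff:
  "norm (block_op D B C F) \<le> 1 \<longleftrightarrow>
    (\<forall>x y. (norm (D x + B y))\<^sup>2 + (norm (C x + F y))\<^sup>2 \<le> (norm x)\<^sup>2 + (norm y)\<^sup>2)"
    (is "?L \<longleftrightarrow> ?R")
proof
  assume ?L
  then show ?R
    using norm_blinfun_le_1D[of "block_op D B C F" "(_, _)"]
    by (simp add: block_op_apply norm_prod_def)
next
  assume ?R
  then show ?L
    by (intro norm_blinfun_bound) (auto simp: block_op_apply norm_prod_def)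
qed

text \<open>Set one input component to zero and drop the other output component.\<close>

lemma norm_diagonal_blocks_le_1:
  assumes "norm (block_op D B C F) \<le> 1"
  shows "norm D \<le> 1" and "norm F \<le> 1"
proof -
  note le = assms[unfolded norm_block_op_le_1_iff, rule_format]
  show "norm D \<le> 1"
  proof (rule norm_blinfun_bound)
    fix x
    have "(norm (D x))\<^sup>2 \<le> (norm (D x))\<^sup>2 + (norm (C x))\<^sup>2"
      by simp
    also have "\<dots> \<le> (norm x)\<^sup>2"
      using le[of x 0] by (simp add: add.commute)
    finally show "norm (D x) \<le> 1 * norm x"
      using power2_le_imp_le[of "norm (D x)" "norm x"] by simp
  qed simp
  show "norm F \<le> 1"
  proof (rule norm_blinfun_bound)
    fix y
    have "(norm (F y))\<^sup>2 \<le> (norm (F y))\<^sup>2 + (norm (B y))\<^sup>2"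
      by simp
    also have "\<dots> \<le> (norm y)\<^sup>2"
      using le[of 0 y] by (simp add: add.commute)
    finally show "norm (F y) \<le> 1 * norm y"
      using power2_le_imp_le[of "norm (F y)" "norm y"] by simp
  qed simp
qed

text \<open>With \<open>p = R (s x - a B y)\<close> and \<open>q = A p + B y\<close>, where \<open>s\<^sup>2 = 1 - a\<^sup>2\<close>, the original
  system maps \<open>(p, y)\<close> to some \<open>(q, r)\<close>, and the transformed one maps
  \<open>(x, y) = ((p + a q) / s, y)\<close> to \<open>((a p + q) / s, r)\<close>.  This hyperbolic rotation of \<open>(p, q)\<close>
  preserves \<open>\<parallel>p\<parallel>\<^sup>2 - \<parallel>q\<parallel>\<^sup>2\<close>.\<close>
lemma mobius_transform_norm_le_1:
  fixes A R :: "'m::real_inner \<Rightarrow>\<^sub>L 'm" and B :: "'k::real_inner \<Rightarrow>\<^sub>L 'm"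
  assumes contr: "norm (block_op A B C G) \<le> 1" and a: "\<bar>a\<bar> < 1"
    and R: "\<And>x. R x + a *\<^sub>R A (R x) = x"
  shows "norm (block_op ((a *\<^sub>R id_blinfun + A) o\<^sub>L R) (sqrt (1 - a\<^sup>2) *\<^sub>R (R o\<^sub>L B))
    (sqrt (1 - a\<^sup>2) *\<^sub>R (C o\<^sub>L R)) (G - a *\<^sub>R (C o\<^sub>L R o\<^sub>L B))) \<le> 1"
  unfolding norm_block_op_le_1_iff
proof (intro allI)
  fix x y
  define s where "s = sqrt (1 - a\<^sup>2)"
  have s2: "s * s = 1 - a * a" and s0: "s \<noteq> 0"
    using a abs_square_less_1[of a] by (auto simp: s_def power2_eq_square)
  define p where "p = R (s *\<^sub>R x - a *\<^sub>R B y)"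
  define q where "q = A p + B y"
  \<comment> \<open>Used to trade \<open>a A R\<close> for \<open>I - R\<close>, so that the
    coefficient \<open>s * s = 1 - a * a\<close> of \<open>R (B y)\<close> can be absorbed.\<close>
  have AR: "a *\<^sub>R A (R u) = u - R u" for u
    using R[of u] by (simp add: algebra_simps)
  have x: "s *\<^sub>R x = p + a *\<^sub>R q"
    using R[of "s *\<^sub>R x - a *\<^sub>R B y"] by (simp add: p_def q_def algebra_simps)
  define x' where "x' = ((a *\<^sub>R id_blinfun + A) o\<^sub>L R) x + (s *\<^sub>R (R o\<^sub>L B)) y"
  have x': "s *\<^sub>R x' = a *\<^sub>R p + q"
  proof -
    have "s *\<^sub>R x' = s *\<^sub>R a *\<^sub>R R x + s *\<^sub>R A (R x) + (s * s) *\<^sub>R R (B y)"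
      by (simp add: x'_def blinfun.bilinear_simps scaleR_add_right)
    also have "\<dots> = s *\<^sub>R a *\<^sub>R R x + s *\<^sub>R A (R x) + (R (B y) - (a * a) *\<^sub>R R (B y))"
      by (simp add: s2 scaleR_left_diff_distrib)
    also have "\<dots> = a *\<^sub>R s *\<^sub>R R x + s *\<^sub>R A (R x)
        - (a * a) *\<^sub>R R (B y) - a *\<^sub>R A (R (B y)) + B y"
      unfolding AR by simp
    also have "\<dots> = a *\<^sub>R p + q"
      by (simp add: p_def q_def blinfun.bilinear_simps scaleR_diff_right)
    finally show ?thesis .
  qed
  have y': "(s *\<^sub>R (C o\<^sub>L R)) x + (G - a *\<^sub>R (C o\<^sub>L R o\<^sub>L B)) y = C p + G y"
    unfolding p_def by (simp add: blinfun.bilinear_simps)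
  \<comment> \<open>In the difference of the squared norms of \<open>p + a q\<close> and
    \<open>a p + q\<close> the cross terms cancel; the common factor \<open>1 - a * a\<close> equals
    \<open>s * s\<close>, which is nonzero.\<close>
  have "s * s * ((norm x)\<^sup>2 - (norm x')\<^sup>2) = (norm (s *\<^sub>R x))\<^sup>2 - (norm (s *\<^sub>R x'))\<^sup>2"
    by (simp add: power_mult_distrib algebra_simps power2_eq_square)
  also have "\<dots> = (1 - a * a) * ((norm p)\<^sup>2 - (norm q)\<^sup>2)"
    unfolding x x' power2_norm_eq_inner
    by (simp add: inner_add inner_commute[of p q] algebra_simps)
  finally have "(norm x)\<^sup>2 - (norm x')\<^sup>2 = (norm p)\<^sup>2 - (norm q)\<^sup>2"
    using s2 s0 by (metis mult_cancel_left mult_eq_0_iff)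
  moreover have "(norm q)\<^sup>2 + (norm (C p + G y))\<^sup>2 \<le> (norm p)\<^sup>2 + (norm y)\<^sup>2"
    using contr unfolding norm_block_op_le_1_iff q_def by blast
  ultimately have "(norm x')\<^sup>2 + (norm (C p + G y))\<^sup>2 \<le> (norm x)\<^sup>2 + (norm y)\<^sup>2"
    by linarith
  then show "(norm (((a *\<^sub>R id_blinfun + A) o\<^sub>L R) x + (sqrt (1 - a\<^sup>2) *\<^sub>R (R o\<^sub>L B)) y))\<^sup>2 +
      (norm ((sqrt (1 - a\<^sup>2) *\<^sub>R (C o\<^sub>L R)) x + (G - a *\<^sub>R (C o\<^sub>L R o\<^sub>L B)) y))\<^sup>2
      \<le> (norm x)\<^sup>2 + (norm y)\<^sup>2"
    unfolding s_def[symmetric] y' x'_def .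
qed

text \<open>\<open>R\<close> inherits symmetry from \<open>I + a A\<close>; then \<open>R B\<close>
  and \<open>C R\<close> are mutually adjoint and \<open>C R B\<close> is symmetric.\<close>

lemma mobius_transform_selfadjoint:
  fixes A R :: "'m::complex_hilbert_space \<Rightarrow>\<^sub>L 'm"
    and B :: "'k::complex_hilbert_space \<Rightarrow>\<^sub>L 'm"
  assumes sa: "selfadjoint (block_op A B C G)"
    and R: "\<And>x. R x + a *\<^sub>R A (R x) = x"
  shows "selfadjoint (block_op ((a *\<^sub>R id_blinfun + A) o\<^sub>L R) (s *\<^sub>R (R o\<^sub>L B))
    (s *\<^sub>R (C o\<^sub>L R)) (G - a *\<^sub>R (C o\<^sub>L R o\<^sub>L B)))"
proof -
  have A: "cinner (A x) x' = cinner x (A x')" and G: "cinner (G y) y' = cinner y (G y')"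
    and BC: "cinner (B y) x = cinner y (C x)" for x x' y y'
    using sa unfolding selfadjoint_block_op_iff by (simp_all add: selfadjoint_def)
  have CB: "cinner (C x) y = cinner x (B y)" for x y
    by (metis BC cinner_commute)
  have RR: "cinner (R x) y = cinner x (R y)" for x y
  proof -
    have "cinner (R x) (R y + a *\<^sub>R A (R y)) = cinner (R x + a *\<^sub>R A (R x)) (R y)"
      by (simp add: cinner_add_left cinner_add_right cinner_scaleR_left cinner_scaleR_right A)
    then show ?thesis by (simp only: R)
  qed
  \<comment> \<open>Writing \<open>x\<close> and \<open>y\<close> as \<open>(I + a A) R x\<close>
    and \<open>(I + a A) R y\<close> makes both sides the same expression in \<open>R x\<close> and
    \<open>R y\<close>, by symmetry of \<open>A\<close>.\<close>
  have "cinner (a *\<^sub>R R x + A (R x)) y = cinner x (a *\<^sub>R R y + A (R y))" for x y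
  proof -
    have "cinner (a *\<^sub>R R x + A (R x)) (R y + a *\<^sub>R A (R y)) =
        cinner (R x + a *\<^sub>R A (R x)) (a *\<^sub>R R y + A (R y))"
      by (simp add: cinner_add_left cinner_add_right cinner_scaleR_left cinner_scaleR_right A
          algebra_simps)
    then show ?thesis by (simp only: R)
  qed
  then show ?thesis
    unfolding selfadjoint_block_op_iff unfolding selfadjoint_def
    by (simp add: blinfun.bilinear_simps cinner_diff_left cinner_diff_right
        cinner_scaleR_left cinner_scaleR_right G CB BC RR)
qed

text \<open>The invertibility conjuncts certify that every \<open>op_inverse\<close> involved is a
  genuine inverse.\<close>

theorem proposition6p10:
  fixes A :: "'m::complex_hilbert_space \<Rightarrow>\<^sub>L 'm"
    and B :: "'k::complex_hilbert_space \<Rightarrow>\<^sub>L 'm"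
    and G :: "'k \<Rightarrow>\<^sub>L 'k"
    and \<tau> \<sigma> :: "('m \<times> 'k) \<Rightarrow>\<^sub>L ('m \<times> 'k)"
    and \<Omega> :: "complex \<Rightarrow> ('m \<Rightarrow>\<^sub>L 'm)"
    and R :: "'m \<Rightarrow>\<^sub>L 'm"
    and a :: real
  assumes \<tau>: "\<tau> = block_op A B (cadjoint B) G"
    and system: "passive_selfadjoint_system \<tau>"
    and \<Omega>: "\<And>z. z \<in> \<E> \<Longrightarrow> \<Omega> z = transfer_function \<tau> z"
    and a: "a \<in> {-1<..<1}"
    and R: "R = op_inverse (id_blinfun + a *\<^sub>R A)"
    and \<sigma>: "\<sigma> = block_op
          ((a *\<^sub>R id_blinfun + A) o\<^sub>L R)
          (sqrt (1 - a\<^sup>2) *\<^sub>R (R o\<^sub>L B))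
          (sqrt (1 - a\<^sup>2) *\<^sub>R (cadjoint B o\<^sub>L R))
          (G - a *\<^sub>R (cadjoint B o\<^sub>L R o\<^sub>L B))"
  shows "op_invertible (id_blinfun + a *\<^sub>R A) \<and>
    passive_selfadjoint_system \<sigma> \<and>
    (\<forall>z\<in>\<E>.
      op_invertible (id_blinfun - z *\<^sub>C block22 \<tau>) \<and>
      op_invertible (id_blinfun - z *\<^sub>C block22 \<sigma>) \<and>
      op_invertible (id_blinfun + a *\<^sub>R \<Omega> z) \<and>
      transfer_function \<sigma> z =
        (a *\<^sub>R id_blinfun + \<Omega> z) o\<^sub>L op_inverse (id_blinfun + a *\<^sub>R \<Omega> z))"
proof -
  define C where "C = cadjoint B"
  define s where "s = sqrt (1 - a\<^sup>2)"
  define P where "P = id_blinfun + a *\<^sub>R A"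
  define H where "H = G - a *\<^sub>R (C o\<^sub>L R o\<^sub>L B)"
  have a1: "\<bar>a\<bar> < 1" using a by auto
  then have s2: "s * s = 1 - a * a"
    using abs_square_less_1[of a] by (auto simp: s_def power2_eq_square)
  have \<tau>': "\<tau> = block_op A B C G" and \<sigma>': "\<sigma> = block_op ((a *\<^sub>R id_blinfun + A) o\<^sub>L R)
      (s *\<^sub>R (R o\<^sub>L B)) (s *\<^sub>R (C o\<^sub>L R)) H"
    by (simp_all add: \<tau> \<sigma> C_def s_def H_def)
  have lin: "complex_linear \<tau>" and sa: "selfadjoint \<tau>" and contr: "norm \<tau> \<le> 1"
    using system unfolding passive_selfadjoint_system_def by simp_all
  have linA: "complex_linear A" and linB: "complex_linear B" and linC: "complex_linear C"
    and linG: "complex_linear G"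
    using lin unfolding \<tau>' complex_linear_block_op_iff by simp_all
  have invP: "op_invertible P"
    unfolding P_def using contr a1
    by (auto simp: \<tau>' intro: op_invertible_id_add_scaleR norm_diagonal_blocks_le_1)
  have linP: "complex_linear P"
    using linA
    by (simp add: complex_linear_def P_def blinfun.bilinear_simps scaleC_add_right scaleC_scaleR)
  have linR: "complex_linear R"
    unfolding R P_def[symmetric] by (rule complex_linear_op_inverse[OF linP invP])
  have PR: "P (R x) = x" and RP: "R (P x) = x" for x
    using op_inverse_right[OF invP] op_inverse_left[OF invP] unfolding R P_def by simp_all
  have R_eq: "R x + a *\<^sub>R A (R x) = x" for x
    using PR[of x] by (simp add: P_def blinfun.bilinear_simps)
  have sa': "selfadjoint \<sigma>"
    unfolding \<sigma>' H_def using sa[unfolded \<tau>'] R_eq by (rule mobius_transform_selfadjoint)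
  have contr': "norm \<sigma> \<le> 1"
    unfolding \<sigma>' H_def s_def using contr[unfolded \<tau>'] a1 R_eq by (rule mobius_transform_norm_le_1)
  have linH: "complex_linear H"
    using linG linC linR linB unfolding H_def
    by (simp add: complex_linear_def blinfun.bilinear_simps scaleC_diff_right scaleC_scaleR)
  have lin': "complex_linear \<sigma>"
    unfolding \<sigma>' complex_linear_block_op_iff using linA linC linR linB linH
    by (simp add: complex_linear_def blinfun.bilinear_simps scaleC_add_right scaleC_scaleR)
  have psys: "passive_selfadjoint_system \<sigma>"
    using lin' sa' contr' unfolding passive_selfadjoint_system_def by simp
  \<comment> \<open>The transfer function of \<open>\<sigma>\<close> refers to this adjoint;
    selfadjointness of \<open>\<sigma>\<close> identifies it with the lower left block.\<close>
  have cadj: "cadjoint (s *\<^sub>R (R o\<^sub>L B)) = s *\<^sub>R (C o\<^sub>L R)"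
    using sa' unfolding \<sigma>' selfadjoint_block_op_iff by (blast intro: cadjoint_eqI)
  have "op_invertible (id_blinfun - z *\<^sub>C block22 \<tau>) \<and>
      op_invertible (id_blinfun - z *\<^sub>C block22 \<sigma>) \<and>
      op_invertible (id_blinfun + a *\<^sub>R \<Omega> z) \<and>
      transfer_function \<sigma> z =
        (a *\<^sub>R id_blinfun + \<Omega> z) o\<^sub>L op_inverse (id_blinfun + a *\<^sub>R \<Omega> z)" if z: "z \<in> \<E>" for z
  proof -
    define K where "K = id_blinfun - z *\<^sub>C G"
    define L where "L = id_blinfun - z *\<^sub>C H"
    define Q where "Q = op_inverse K"
    define V where "V = op_inverse L"
    have K: "K y = y - z *\<^sub>C G y" for y
      by (simp add: K_def blinfun.bilinear_simps scaleC_blinfun.rep_eq)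
    have L: "L y = y - z *\<^sub>C H y" for y
      by (simp add: L_def blinfun.bilinear_simps scaleC_blinfun.rep_eq)
    have invK: "op_invertible K"
      unfolding K_def using contr sa z
      by (auto simp: \<tau>' selfadjoint_block_op_iff
          intro: op_invertible_id_diff_scaleC norm_diagonal_blocks_le_1)
    have invL: "op_invertible L"
      unfolding L_def using contr' sa' z
      by (auto simp: \<sigma>' selfadjoint_block_op_iff
          intro: op_invertible_id_diff_scaleC norm_diagonal_blocks_le_1)
    have linK: "complex_linear K" and linL: "complex_linear L"
      using linG linH
      by (simp_all add: complex_linear_def K L scaleC_diff_right scaleC_scaleC mult.commute)
    have linQ: "complex_linear Q" and linV: "complex_linear V"
      unfolding Q_def V_def using linK invK linL invL by (auto intro: complex_linear_op_inverse)
    note lins = linA linB linC linG linP linR linQ linV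
    note l = lins[unfolded complex_linear_def, rule_format]
    \<comment> \<open>Thus \<open>V\<close>, the state resolvent of \<open>\<sigma>\<close>, is the
      inverse that the Woodbury identity requires for \<open>c = a z\<close>.\<close>
    have KL: "K y + (of_real a * z) *\<^sub>C C (R (B y)) = L y" for y
      by (simp add: K L H_def blinfun.bilinear_simps scaleC_diff_right scaleC_scaleR
          scaleC_scaleC[symmetric] scaleC_of_real)
    have KQ: "K (Q y) = y" "Q (K y) = y" and LV: "L (V y) = y" "V (L y) = y" for y
      unfolding Q_def V_def
      by (simp_all add: op_inverse_left op_inverse_right invK invL)
    define W where "W = R - (of_real a * z) *\<^sub>C (R o\<^sub>L B o\<^sub>L V o\<^sub>L C o\<^sub>L R)"
    note wb = linP linR linB linC linQ linV PR RP KQ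
      LV(1)[folded KL] LV(2)[folded KL]
    have \<Omega>z: "\<Omega> z = A + z *\<^sub>C (B o\<^sub>L Q o\<^sub>L C)"
      using \<Omega>[OF z] unfolding transfer_function_def \<tau>'
      by (simp add: block11_block_op block12_block_op block22_block_op C_def K_def Q_def)
    have N: "id_blinfun + a *\<^sub>R \<Omega> z = P + (of_real a * z) *\<^sub>C (B o\<^sub>L Q o\<^sub>L C)"
      by (simp add: \<Omega>z P_def scaleR_add_right scaleC_scaleC[symmetric] scaleC_of_real)
    have W: "(id_blinfun + a *\<^sub>R \<Omega> z) o\<^sub>L W = id_blinfun"
      "W o\<^sub>L (id_blinfun + a *\<^sub>R \<Omega> z) = id_blinfun"
      "Q (C (W x)) = V (C (R x))" for x
      unfolding N W_def
      by (rule woodbury_right[OF wb] woodbury_left[OF wb] woodbury_feedback[OF wb])+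
    have invN: "op_invertible (id_blinfun + a *\<^sub>R \<Omega> z)"
      using W(1,2) unfolding op_invertible_def by blast
    have "transfer_function \<sigma> z = ((a *\<^sub>R id_blinfun + A) o\<^sub>L R) +
        z *\<^sub>C ((s *\<^sub>R (R o\<^sub>L B)) o\<^sub>L V o\<^sub>L (s *\<^sub>R (C o\<^sub>L R)))"
      unfolding transfer_function_def \<sigma>'
      by (simp add: block11_block_op block12_block_op block22_block_op cadj L_def V_def)
    also have "\<dots> = (a *\<^sub>R id_blinfun + \<Omega> z) o\<^sub>L W"
    proof (rule blinfun_eqI)
      fix x
      define v where "v = B (V (C (R x)))"
      have AR: "a *\<^sub>R A (R u) = u - R u" for u
        using R_eq[of u] by (simp add: algebra_simps)
      have Wx: "W x = R x - a *\<^sub>R z *\<^sub>C R v"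
        by (simp add: W_def v_def blinfun.bilinear_simps scaleC_blinfun.rep_eq
            scaleC_scaleC[symmetric] scaleC_of_real)
      \<comment> \<open>The feedback identity replaces \<open>Q C W\<close> by \<open>V C R\<close>,
        so the resolvent of \<open>\<tau>\<close> disappears.\<close>
      have "((a *\<^sub>R id_blinfun + \<Omega> z) o\<^sub>L W) x = a *\<^sub>R W x + A (W x) + z *\<^sub>C v"
        by (simp add: \<Omega>z blinfun.bilinear_simps scaleC_blinfun.rep_eq W(3) v_def)
      also have "\<dots> = a *\<^sub>R R x + A (R x) + z *\<^sub>C (v - (a * a) *\<^sub>R R v - a *\<^sub>R A (R v))"
        by (simp add: Wx blinfun.bilinear_simps l scaleC_diff_right scaleC_scaleR
            scaleR_diff_right)
      \<comment> \<open>The factor \<open>1 - a * a\<close> arising here matches the two factors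
        \<open>s\<close> in the off-diagonal blocks of \<open>\<sigma>\<close>.\<close>
      also have "v - (a * a) *\<^sub>R R v - a *\<^sub>R A (R v) = (s * s) *\<^sub>R R v"
        unfolding AR s2 by (simp add: algebra_simps)
      finally show "(((a *\<^sub>R id_blinfun + A) o\<^sub>L R) +
          z *\<^sub>C ((s *\<^sub>R (R o\<^sub>L B)) o\<^sub>L V o\<^sub>L (s *\<^sub>R (C o\<^sub>L R)))) x =
          ((a *\<^sub>R id_blinfun + \<Omega> z) o\<^sub>L W) x"
        by (simp add: blinfun.bilinear_simps scaleC_blinfun.rep_eq v_def)
    qed
    also have "W = op_inverse (id_blinfun + a *\<^sub>R \<Omega> z)"
      by (rule op_inverse_eqI[OF W(1,2), symmetric])
    finally show ?thesis
      using invK invL invN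
      by (simp add: \<tau>' \<sigma>' block22_block_op K_def L_def)
  qed
  then show ?thesis using invP psys unfolding P_def by blast
qed

end
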